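(* Let $X=\{X_Q\}_Q$ be a family of normalized quasi-Banach function spaces, indexed by the cubes $Q\subset\mathbb{R}^n$. Suppose that either of the following conditions holds: (i) There is a constant $c>0$ such that for any cube $Q$ and any measurable $E\subset Q$ with $|E|\ge\frac12|Q|$, we have $\|\chi_E\|_{X_Q}\ge c$. (ii) $\mathrm{BMO}_X^*=\mathrm{BMO}_X$ (equality of spaces with equivalent seminorms). Then $\mathrm{BMO}_X^*\hookrightarrow\mathrm{BMO}$, i.e. every $f\in\mathrm{BMO}_X^*$ belongs to $\mathrm{BMO}$ and there is a constant $C>0$ such that $\|f\|_{\mathrm{BMO}}\le C\|f\|_{\mathrm{BMO}_X^*}$ for all $f\in\mathrm{BMO}_X^*$.
   Context: Cubes $Q\subset\mathbb{R}^n$ have sides parallel to the axes, and $\langle f\rangle_Q:=\frac1{|Q|}\int_Q f$. A quasi-Banach function space over a cube $Q$ is an order ideal $X_Q$ of the space of measurable functions $Q\to\mathbb{R}$, equipped with a quasi-norm $\|\cdot\|_{X_Q}$, such that: (Compatibility) if $f,g\in X_Q$ and $|f|\le|g|$ then $\|f\|_{X_Q}\le\|g\|_{X_Q}$; (Weak order unit) there is $f\in X_Q$ with $f>0$ a.e.; (Fatou property) if $0\le f_m\uparrow f$ with $f_m \in X_Q$ and $\sup_m\|f_m\|_{X_Q}<\infty$, then $f\in X_Q$ and $\|f\|_{X_Q}=\sup_m\|f_m\|_{X_Q}$. We put $\|f\|_{X_Q}=\infty$ if $f\notin X_Q$; for $f$ defined on $\mathbb{R}^n$, $\|f\|_{X_Q}$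 means the quasi-norm of the restriction of $f$ to $Q$. $X=\{X_Q\}$ is a family of normalized quasi-Banach function spaces if for every cube $Q$, $X_Q$ is a quasi-Banach function space over $Q$ and $\|\chi_Q\|_{X_Q}\simeq1$, with implicit constants independent of $Q$. $\mathrm{BMO}$ is the space of locally integrable $f:\mathbb{R}^n\to\mathbb{R}$ with $\|f\|_{\mathrm{BMO}}:=\sup_Q\frac1{|Q|}\int_Q|f-\langle f\rangle_Q|<\infty$. $\mathrm{BMO}_X$ is the space of locally integrable $f:\mathbb{R}^n\to\mathbb{R}$ with $\|f\|_{\mathrm{BMO}_X}:=\sup_Q\|f-\langle f\rangle_Q\|_{X_Q}<\infty$. $\mathrm{BMO}_X^*$ is the space of measurable $f:\mathbb{R}^n\to\mathbb{R}$ (no local integrability assumed) with $\|f\|_{\mathrm{BMO}_X^*}:=\sup_Q\inf_{c\in\mathbb{R}}\|f-c\|_{X_Q}<\infty$.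
   Formalization: In alternative (ii) it is additionally assumed that the quasi-triangle constants of the quasi-norms of X_Q are bounded uniformly in Q; without this, (ii) does not imply the conclusion (there is a counterexample for n=1 with f(x)=x^2). Alternative (i) is unchanged. *)

theory Defs imports "HOL-Analysis.Analysis" begin

text \<open>Cubes are closed, nondegenerate and have sides parallel to the axes.\<close>

definition cube :: "'a::euclidean_space set \<Rightarrow> bool" where
  "cube Q \<longleftrightarrow> (\<exists>a l. l > 0 \<and> Q = cbox a (a + l *\<^sub>R One))"

definition average :: "'a::euclidean_space set \<Rightarrow> ('a \<Rightarrow> real) \<Rightarrow> real" where
  "average Q f = (LINT x:Q|lebesgue. f x) / measure lebesgue Q"

definition locally_integrable :: "('a::euclidean_space \<Rightarrow> real) \<Rightarrow> bool" where
  "locally_integrable f \<longleftrightarrow> (\<forall>K. compact K \<longrightarrow> f absolutely_integrable_on K)"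

text \<open>A set of functions together with a real-valued functional on it. A function on a
  cube \<open>Q\<close> is represented by any function on the whole space that agrees with it on \<open>Q\<close>.
  In \<open>quasi_banach_fs\<close> all (in)equalities hold almost everywhere on \<open>Q\<close>, so membership and
  quasi-norm depend only on the a.e. class of the restriction to \<open>Q\<close>.\<close>

record 'a fspace =
  members :: "('a \<Rightarrow> real) set"
  qnorm :: "('a \<Rightarrow> real) \<Rightarrow> real"

definition quasi_triangle :: "real \<Rightarrow> 'a fspace \<Rightarrow> bool" where
  "quasi_triangle K S \<longleftrightarrow>
     (\<forall>f\<in>members S. \<forall>g\<in>members S. qnorm S (\<lambda>x. f x + g x) \<le> K * (qnorm S f + qnorm S g))"

definition order_ideal_on :: "'a::euclidean_space set \<Rightarrow> ('a \<Rightarrow> real) set \<Rightarrow> bool" where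
  "order_ideal_on Q V \<longleftrightarrow>
     V \<subseteq> borel_measurable (lebesgue_on Q) \<and>
     (\<lambda>x. 0) \<in> V \<and>
     (\<forall>f\<in>V. \<forall>g\<in>V. (\<lambda>x. f x + g x) \<in> V) \<and>
     (\<forall>f\<in>V. \<forall>r. (\<lambda>x. r * f x) \<in> V) \<and>
     (\<forall>f\<in>V. \<forall>g\<in>borel_measurable (lebesgue_on Q).
        (AE x in lebesgue_on Q. \<bar>g x\<bar> \<le> \<bar>f x\<bar>) \<longrightarrow> g \<in> V)"

definition quasi_norm_on :: "'a::euclidean_space set \<Rightarrow> 'a fspace \<Rightarrow> bool" where
  "quasi_norm_on Q S \<longleftrightarrow>
     (\<forall>f\<in>members S. 0 \<le> qnorm S f) \<and>
     (\<forall>f\<in>members S. qnorm S f = 0 \<longleftrightarrow> (AE x in lebesgue_on Q. f x = 0)) \<and>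
     (\<forall>f\<in>members S. \<forall>r. qnorm S (\<lambda>x. r * f x) = \<bar>r\<bar> * qnorm S f) \<and>
     (\<exists>K. quasi_triangle K S)"

text \<open>Completeness is not listed separately: it follows from the Fatou property.\<close>

definition quasi_banach_fs :: "'a::euclidean_space set \<Rightarrow> 'a fspace \<Rightarrow> bool" where
  "quasi_banach_fs Q S \<longleftrightarrow>
     order_ideal_on Q (members S) \<and>
     quasi_norm_on Q S \<and>
     (\<comment> \<open>compatibility\<close>
      \<forall>f\<in>members S. \<forall>g\<in>members S.
        (AE x in lebesgue_on Q. \<bar>f x\<bar> \<le> \<bar>g x\<bar>) \<longrightarrow> qnorm S f \<le> qnorm S g) \<and>
     (\<comment> \<open>weak order unit\<close>
      \<exists>f\<in>members S. AE x in lebesgue_on Q. 0 < f x) \<and>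
     (\<comment> \<open>Fatou property\<close>
      \<forall>F. \<forall>f\<in>borel_measurable (lebesgue_on Q).
        (\<forall>m::nat. F m \<in> members S) \<and>
        (\<forall>m. AE x in lebesgue_on Q. 0 \<le> F m x \<and> F m x \<le> F (Suc m) x) \<and>
        (AE x in lebesgue_on Q. (\<lambda>m. F m x) \<longlonglongrightarrow> f x) \<and>
        bdd_above (range (\<lambda>m. qnorm S (F m)))
        \<longrightarrow> f \<in> members S \<and> qnorm S f = (SUP m. qnorm S (F m)))"

definition ext_qnorm :: "'a fspace \<Rightarrow> ('a \<Rightarrow> real) \<Rightarrow> ennreal" where
  "ext_qnorm S f = (if f \<in> members S then ennreal (qnorm S f) else \<infinity>)"

text \<open>A family of spaces is a map on sets, of which only the values at cubes matter.
  The constant in the quasi-triangle inequality of the space over \<open>Q\<close> may depend on \<open>Q\<close>.\<close>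

definition normalized_qbfs_family :: "('a::euclidean_space set \<Rightarrow> 'a fspace) \<Rightarrow> bool" where
  "normalized_qbfs_family X \<longleftrightarrow>
     (\<forall>Q. cube Q \<longrightarrow> quasi_banach_fs Q (X Q)) \<and>
     (\<exists>a b. 0 < a \<and> 0 < b \<and>
        (\<forall>Q. cube Q \<longrightarrow> ennreal a \<le> ext_qnorm (X Q) (indicat_real Q) \<and>
                       ext_qnorm (X Q) (indicat_real Q) \<le> ennreal b))"

definition uniform_quasi_triangle :: "('a::euclidean_space set \<Rightarrow> 'a fspace) \<Rightarrow> bool" where
  "uniform_quasi_triangle X \<longleftrightarrow> (\<exists>K. \<forall>Q. cube Q \<longrightarrow> quasi_triangle K (X Q))"

definition bmo_norm :: "('a::euclidean_space \<Rightarrow> real) \<Rightarrow> ennreal" where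
  "bmo_norm f = (SUP Q\<in>{Q. cube Q}. ennreal (average Q (\<lambda>x. \<bar>f x - average Q f\<bar>)))"

definition BMO :: "('a::euclidean_space \<Rightarrow> real) set" where
  "BMO = {f. locally_integrable f \<and> bmo_norm f < \<infinity>}"

definition bmoX_norm ::
  "('a::euclidean_space set \<Rightarrow> 'a fspace) \<Rightarrow> ('a \<Rightarrow> real) \<Rightarrow> ennreal" where
  "bmoX_norm X f = (SUP Q\<in>{Q. cube Q}. ext_qnorm (X Q) (\<lambda>x. f x - average Q f))"

definition BMOX :: "('a::euclidean_space set \<Rightarrow> 'a fspace) \<Rightarrow> ('a \<Rightarrow> real) set" where
  "BMOX X = {f. locally_integrable f \<and> bmoX_norm X f < \<infinity>}"

definition bmoX_star_norm ::
  "('a::euclidean_space set \<Rightarrow> 'a fspace) \<Rightarrow> ('a \<Rightarrow> real) \<Rightarrow> ennreal" where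
  "bmoX_star_norm X f = (SUP Q\<in>{Q. cube Q}. INF c. ext_qnorm (X Q) (\<lambda>x. f x - c))"

definition BMOX_star :: "('a::euclidean_space set \<Rightarrow> 'a fspace) \<Rightarrow> ('a \<Rightarrow> real) set" where
  "BMOX_star X = {f \<in> borel_measurable lebesgue. bmoX_star_norm X f < \<infinity>}"

end

theory Submission imports Defs begin

text \<open>
  Under (ii), the near-optimal constant \<open>c\<close> of \<open>f\<close> on a cube \<open>Q\<close> makes \<open>g = \<bar>f - c\<bar>\<close> a function of
  starred seminorm at most that of \<open>f\<close>, because \<open>t \<mapsto> \<bar>t - c\<bar>\<close> is 1-Lipschitz. On \<open>Q\<close> both \<open>g\<close> and, by
  (ii), \<open>g - \<langle>g\<rangle>\<^sub>Q\<close> have controlled quasi-norm, hence so does the constant \<open>\<langle>g\<rangle>\<^sub>Q\<close>.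

  Under (i), there is \<open>t\<close> comparable to the seminorm such that every cube \<open>Q\<close> has a constant \<open>c\<close> with
  \<open>\<bar>f - c\<bar> \<le> t\<close> on strictly more than half of \<open>Q\<close>, and the claim is the critical case \<open>s = 1/2\<close> of the
  John--Stromberg theorem. Normalise \<open>t = 1\<close> and \<open>c = 0\<close> on \<open>Q0\<close> and let \<open>k \<ge> 1\<close>. For almost every
  \<open>x \<in> Q0\<close> with \<open>f x > k\<close>, deform \<open>Q0\<close> continuously to a small cube at \<open>x\<close>, through cubes that lie in \<open>Q0\<close>
  and contain \<open>x\<close>. By the intermediate value theorem one of them is split by \<open>f \<le> k\<close> into two halves of
  equal measure; the majority set of that cube meets both halves, so its constant is within \<open>1\<close> of \<open>k\<close>
  and \<open>\<bar>f - k\<bar> \<le> 2\<close> on most of it. The Vitali covering lemma then bounds the measure of \<open>{f > k}\<close> by that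
  of \<open>{\<bar>f - k\<bar> \<le> 2}\<close>, and summing over \<open>k\<close> bounds the integral of the positive part of \<open>f\<close>.
\<close>

section \<open>Cubes split into halves by a set\<close>

lemma emeasure_cube:
  fixes a :: "'a::euclidean_space"
  assumes "0 \<le> l"
  shows "emeasure lebesgue (cbox a (a + l *\<^sub>R One)) = ennreal (l ^ DIM('a))"
  using assms by (simp add: emeasure_lborel_cbox_eq inner_add_left prod_constant)

lemma measure_cube:
  fixes a :: "'a::euclidean_space"
  assumes "0 \<le> l"
  shows "measure lebesgue (cbox a (a + l *\<^sub>R One)) = l ^ DIM('a)"
  using emeasure_cube[OF assms, of a] assms by (simp add: measure_def)

lemma cubeE:
  fixes Q :: "'a::euclidean_space set"
  assumes "cube Q"
  obtains a l where "l > 0" "Q = cbox a (a + l *\<^sub>R One)"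
  using assms unfolding cube_def by blast

lemma cube_lmeasurable: "cube Q \<Longrightarrow> Q \<in> lmeasurable"
  by (auto elim!: cubeE)

lemma cube_measure_pos: "cube Q \<Longrightarrow> 0 < measure lebesgue Q"
  by (auto elim!: cubeE simp: measure_cube simp del: measure_completion)

lemma indicator_integrable_cbox:
  fixes F :: "'a::euclidean_space set"
  assumes "F \<in> sets lebesgue"
  shows "indicat_real F integrable_on cbox a b"
    and "integral (cbox a b) (indicat_real F) = measure lebesgue (cbox a b \<inter> F)"
proof -
  have *: "cbox a b \<inter> F \<in> lmeasurable"
    using assms by (simp add: fmeasurable_Int_fmeasurable)
  show "indicat_real F integrable_on cbox a b"
    using * by (metis inf_commute integrable_on_indicator)
  show "integral (cbox a b) (indicat_real F) = measure lebesgue (cbox a b \<inter> F)"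
    using * by (metis inf_commute integral_indicator)
qed

text \<open>The lower corner and the side length are interpolated linearly between the big cube
  (\<open>t = 0\<close>) and the small cube with lower corner \<open>x\<close>
  (\<open>t = 1\<close>). Every intermediate cube contains \<open>x\<close> and stays in the big
  one, and \<open>F\<close> fills at least half of the first cube and at most half of the last, so
  the intermediate value theorem applies.\<close>

lemma balanced_cube_at_point:
  fixes F :: "'a::euclidean_space set"
  assumes F: "F \<in> sets lebesgue" and l: "l > 0"
    and big: "measure lebesgue (cbox a (a + l *\<^sub>R One) \<inter> F) \<ge> l ^ DIM('a) / 2"
    and h: "0 < h" "\<And>i. i \<in> Basis \<Longrightarrow> a \<bullet> i \<le> x \<bullet> i \<and> x \<bullet> i + h \<le> a \<bullet> i + l"
    and small: "measure lebesgue (cbox x (x + h *\<^sub>R One) \<inter> F) \<le> h ^ DIM('a) / 2"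
  obtains Q where "cube Q" "x \<in> Q" "Q \<subseteq> cbox a (a + l *\<^sub>R One)"
    "measure lebesgue (Q \<inter> F) = measure lebesgue Q / 2"
proof -
  let ?Q0 = "cbox a (a + l *\<^sub>R One)"
  define A where "A t = (1 - t) *\<^sub>R a + t *\<^sub>R x" for t
  define L where "L t = (1 - t) * l + t * h" for t
  define B where "B t = A t + L t *\<^sub>R One" for t
  \<comment> \<open>The excess of \<open>F\<close> over half of the cube. It is written with an
    integral because continuity in both corners is then that of an indefinite integral.\<close>
  define \<psi> where "\<psi> t = integral (cbox (A t) (B t)) (indicat_real F) - L t ^ DIM('a) / 2" for t
  have AB: "a \<bullet> i \<le> A t \<bullet> i \<and> A t \<bullet> i \<le> x \<bullet> i \<and> x \<bullet> i \<le> B t \<bullet> i \<and> B t \<bullet> i \<le> a \<bullet> i + l"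
    if "t \<in> {0..1}" "i \<in> Basis" for t i
  proof -
    have A: "A t \<bullet> i = a \<bullet> i + t * (x \<bullet> i - a \<bullet> i)"
      by (simp add: A_def algebra_simps)
    \<comment> \<open>The first form shows that the upper corner stays beyond \<open>x\<close>, the
      second that it stays below the upper corner of the big cube.\<close>
    have B: "B t \<bullet> i = x \<bullet> i + t * h + (1 - t) * (a \<bullet> i + l - x \<bullet> i)"
      "B t \<bullet> i = a \<bullet> i + l - t * (a \<bullet> i + l - (x \<bullet> i + h))"
      using that(2) by (simp_all add: A_def B_def L_def algebra_simps)
    have "0 \<le> t * (x \<bullet> i - a \<bullet> i)" "0 \<le> (1 - t) * (x \<bullet> i - a \<bullet> i)"
      "0 \<le> t * h" "0 \<le> (1 - t) * (a \<bullet> i + l - x \<bullet> i)"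
      "0 \<le> t * (a \<bullet> i + l - (x \<bullet> i + h))"
      using that h(1) h(2)[OF that(2)] by (auto intro!: mult_nonneg_nonneg)
    then show ?thesis
      unfolding B(2)
      using A B by (simp add: algebra_simps)
  qed
  have sub: "A t \<in> ?Q0" "B t \<in> ?Q0" "x \<in> cbox (A t) (B t)" "cbox (A t) (B t) \<subseteq> ?Q0"
    if "t \<in> {0..1}" for t
  proof -
    show "A t \<in> ?Q0" "B t \<in> ?Q0" "x \<in> cbox (A t) (B t)"
      using AB[OF that] by (fastforce simp: mem_box inner_add_left)+
    then show "cbox (A t) (B t) \<subseteq> ?Q0"
      by (simp add: subset_box_imp mem_box)
  qed
  have contI: "continuous_on {0..1} (\<lambda>t. integral (cbox (A t) (B t)) (indicat_real F))"
    unfolding continuous_on_iff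
  proof (intro ballI allI impI)
    fix t e :: real assume t: "t \<in> {0..1}" and e: "e > 0"
    obtain \<delta> where \<delta>: "0 < \<delta>" "\<And>c' d'. \<lbrakk>c' \<in> ?Q0; d' \<in> ?Q0; norm (c' - A t) \<le> \<delta>; norm (d' - B t) \<le> \<delta>\<rbrakk>
        \<Longrightarrow> norm (integral (cbox c' d') (indicat_real F) - integral (cbox (A t) (B t)) (indicat_real F)) < e"
      using indefinite_integral_continuous[OF indicator_integrable_cbox(1)[OF F] sub(1)[OF t] sub(2)[OF t] e]
      by metis
    have "isCont A t" "isCont B t"
      unfolding A_def B_def L_def by (intro continuous_intros)+
    then have "\<forall>\<^sub>F s in at t. dist (A s) (A t) < \<delta> \<and> dist (B s) (B t) < \<delta>"
      using \<delta>(1) by (intro eventually_conj) (auto simp: isCont_def tendsto_iff)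
    then obtain d where d: "d > 0"
      "\<And>s. s \<noteq> t \<Longrightarrow> dist s t < d \<Longrightarrow> dist (A s) (A t) < \<delta> \<and> dist (B s) (B t) < \<delta>"
      unfolding eventually_at by auto
    show "\<exists>d>0. \<forall>s\<in>{0..1}. dist s t < d \<longrightarrow>
        dist (integral (cbox (A s) (B s)) (indicat_real F)) (integral (cbox (A t) (B t)) (indicat_real F)) < e"
    proof (intro exI conjI ballI impI)
      show "d > 0" by fact
      fix s assume s: "s \<in> {0..1}" "dist s t < d"
      have "norm (A s - A t) \<le> \<delta>" "norm (B s - B t) \<le> \<delta>"
        using d(2)[of s] s(2) \<delta>(1) by (cases "s = t"; force simp: dist_norm)+
      then show "dist (integral (cbox (A s) (B s)) (indicat_real F))
          (integral (cbox (A t) (B t)) (indicat_real F)) < e"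
        using \<delta>(2)[OF sub(1)[OF s(1)] sub(2)[OF s(1)]] by (simp add: dist_norm)
    qed
  qed
  have "continuous_on {0..1} \<psi>"
    unfolding \<psi>_def L_def by (intro continuous_intros contI) auto
  moreover have "\<psi> 1 \<le> 0" "0 \<le> \<psi> 0"
    using big small l h(1)
    by (simp_all add: \<psi>_def A_def B_def L_def indicator_integrable_cbox(2)[OF F])
  ultimately obtain t where t: "t \<in> {0..1}" "\<psi> t = 0"
    using IVT2'[of \<psi> 1 0 0] by auto
  have Lpos: "L t > 0"
  proof (cases "t = 0")
    case False
    then have "0 < t * h" "0 \<le> (1 - t) * l" using t l h by auto
    then show ?thesis by (simp add: L_def)
  qed (use l in \<open>simp add: L_def\<close>)
  show thesis
  proof (rule that)
    show "cube (cbox (A t) (B t))"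
      using Lpos by (auto simp: cube_def B_def)
    show "measure lebesgue (cbox (A t) (B t) \<inter> F) = measure lebesgue (cbox (A t) (B t)) / 2"
      using t(2) Lpos measure_cube[of "L t" "A t"]
      by (simp add: \<psi>_def B_def indicator_integrable_cbox(2)[OF F])
  qed (use sub[OF t(1)] in auto)
qed

text \<open>By Lebesgue differentiation, almost every point outside \<open>F\<close> is the lower
  corner of arbitrarily small cubes in which \<open>F\<close> has density close to 0; these serve as
  the end of the deformation.\<close>

lemma balanced_cubes_almost_everywhere:
  fixes F :: "'a::euclidean_space set"
  assumes F: "F \<in> sets lebesgue" and Q0: "cube Q0"
    and big: "measure lebesgue (Q0 \<inter> F) \<ge> measure lebesgue Q0 / 2"
  obtains N where "negligible N" "\<And>x. x \<in> Q0 - F - N \<Longrightarrow>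
    \<exists>Q. cube Q \<and> x \<in> Q \<and> Q \<subseteq> Q0 \<and> measure lebesgue (Q \<inter> F) = measure lebesgue Q / 2"
proof -
  obtain a l where l: "l > 0" and Q0_eq: "Q0 = cbox a (a + l *\<^sub>R One)"
    using Q0 by (rule cubeE)
  obtain N where N: "negligible N" and dens: "\<And>x e. \<lbrakk>x \<notin> N; 0 < e\<rbrakk> \<Longrightarrow>
      \<exists>d>0. \<forall>h. 0 < h \<and> h < d \<longrightarrow>
        norm (integral (cbox x (x + h *\<^sub>R One)) (indicat_real F) /\<^sub>R h ^ DIM('a) - indicat_real F x) < e"
    using integrable_ccontinuous_explicit[of "indicat_real F"] indicator_integrable_cbox(1)[OF F] by metis
  show thesis
  proof (rule that)
    \<comment> \<open>Discarding the frontier leaves room in \<open>Q0\<close> for a small cube with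
      lower corner \<open>x\<close>.\<close>
    show "negligible (N \<union> frontier Q0)"
      using N by (simp add: Q0_eq negligible_convex_frontier)
    fix x assume x: "x \<in> Q0 - F - (N \<union> frontier Q0)"
    \<comment> \<open>The limit density is 0 because \<open>x\<close> is outside \<open>F\<close>;
      tolerance 1/2 is what the comparison with half of the cube requires.\<close>
    obtain d where d: "d > 0" "\<And>h. 0 < h \<Longrightarrow> h < d \<Longrightarrow>
        norm (integral (cbox x (x + h *\<^sub>R One)) (indicat_real F) /\<^sub>R h ^ DIM('a)) < 1/2"
      using dens[of x "1/2"] x by (auto simp: indicator_def)
    have "x \<in> box a (a + l *\<^sub>R One)"
      using x by (auto simp: Q0_eq frontier_cbox)
    then have xb: "a \<bullet> i < x \<bullet> i \<and> x \<bullet> i < a \<bullet> i + l" if "i \<in> Basis" for i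
      using that by (auto simp: mem_box inner_add_left)
    define m where "m = Min ((\<lambda>i. a \<bullet> i + l - x \<bullet> i) ` Basis)"
    have m: "m > 0" "\<And>i. i \<in> Basis \<Longrightarrow> m \<le> a \<bullet> i + l - x \<bullet> i"
      using xb by (auto simp: m_def)
    define h where "h = min (d/2) m"
    have h: "0 < h" "h < d" "\<And>i. i \<in> Basis \<Longrightarrow> x \<bullet> i + h \<le> a \<bullet> i + l"
      using d m by (auto simp: h_def min_def dest!: m(2))
    have "measure lebesgue (cbox x (x + h *\<^sub>R One) \<inter> F) \<le> h ^ DIM('a) / 2"
      using d(2)[OF h(1,2)] h(1) by (simp add: indicator_integrable_cbox(2)[OF F] field_simps)
    moreover have "measure lebesgue (cbox a (a + l *\<^sub>R One) \<inter> F) \<ge> l ^ DIM('a) / 2"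
      using big l measure_cube[of l a] by (simp add: Q0_eq)
    ultimately obtain Q where "cube Q" "x \<in> Q" "Q \<subseteq> cbox a (a + l *\<^sub>R One)"
      "measure lebesgue (Q \<inter> F) = measure lebesgue Q / 2"
      using balanced_cube_at_point[OF F l _ h(1)] h(3) xb by (metis order.strict_implies_order)
    then show "\<exists>Q. cube Q \<and> x \<in> Q \<and> Q \<subseteq> Q0 \<and> measure lebesgue (Q \<inter> F) = measure lebesgue Q / 2"
      using Q0_eq by blast
  qed
qed

section \<open>Covering by cubes\<close>

lemma cube_subset_cball:
  fixes a :: "'a::euclidean_space"
  assumes "0 \<le> l"
  shows "cbox a (a + l *\<^sub>R One) \<subseteq> cball a (l * DIM('a))"
proof
  fix y assume y: "y \<in> cbox a (a + l *\<^sub>R One)"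
  have "norm (y - a) \<le> (\<Sum>i\<in>Basis. \<bar>(y - a) \<bullet> i\<bar>)"
    by (rule norm_le_l1)
  also have "\<dots> \<le> (\<Sum>i\<in>(Basis::'a set). l)"
    using y by (intro sum_mono) (auto simp: mem_box inner_diff_left inner_add_left abs_le_iff)
  finally show "y \<in> cball a (l * DIM('a))"
    by (simp add: dist_norm norm_minus_commute mult.commute)
qed

lemma cball_subset_cube:
  fixes a :: "'a::euclidean_space"
  shows "cball a r \<subseteq> cbox (a - r *\<^sub>R One) ((a - r *\<^sub>R One) + (2 * r) *\<^sub>R One)"
proof
  fix y assume "y \<in> cball a r"
  then have "\<bar>(y - a) \<bullet> i\<bar> \<le> r" if "i \<in> Basis" for i
    using Basis_le_norm[OF that, of "y - a"] by (simp add: dist_norm norm_minus_commute)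
  then show "y \<in> cbox (a - r *\<^sub>R One) ((a - r *\<^sub>R One) + (2 * r) *\<^sub>R One)"
    by (auto simp: mem_box inner_diff_left inner_add_left abs_le_iff) (metis add.commute diff_le_eq minus_diff_eq minus_le_iff le_diff_eq)+
qed

text \<open>Countable subadditivity in \<open>count_space\<close> form, so that it can be compared
  term by term with \<open>emeasure_UN_countable\<close> for disjoint families.\<close>

lemma emeasure_UN_countable_le:
  assumes [measurable]: "\<And>i. i \<in> I \<Longrightarrow> X i \<in> sets M" and I: "countable I"
  shows "emeasure M (\<Union>i\<in>I. X i) \<le> (\<integral>\<^sup>+i. emeasure M (X i) \<partial>count_space I)"
proof -
  have "(\<Union>i\<in>I. X i) \<in> sets M"
    using assms by auto
  then have "emeasure M (\<Union>i\<in>I. X i) = (\<integral>\<^sup>+x. indicator (\<Union>i\<in>I. X i) x \<partial>M)"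
    by simp
  also have "\<dots> \<le> (\<integral>\<^sup>+x. \<integral>\<^sup>+i. indicator (X i) x \<partial>count_space I \<partial>M)"
  proof (intro nn_integral_mono)
    fix x
    show "indicator (\<Union>i\<in>I. X i) x \<le> (\<integral>\<^sup>+i. indicator (X i) x \<partial>count_space I :: ennreal)"
    proof (cases "x \<in> (\<Union>i\<in>I. X i)")
      case True
      then obtain i where i: "i \<in> I" "x \<in> X i" by blast
      have "indicator (X i) x \<le> (\<integral>\<^sup>+i. indicator (X i) x \<partial>count_space I :: ennreal)"
        using i(1) by (rule nn_integral_ge_point)
      with i show ?thesis by (auto simp: indicator_def)
    qed simp
  qed
  also have "\<dots> = (\<integral>\<^sup>+i. \<integral>\<^sup>+x. indicator (X i) x \<partial>M \<partial>count_space I)"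
    using I by (simp add: nn_integral_count_space_nn_integral)
  also have "\<dots> = (\<integral>\<^sup>+i. emeasure M (X i) \<partial>count_space I)"
    by (intro nn_integral_cong) simp
  finally show ?thesis .
qed

text \<open>A cube of side \<open>l\<close> lies in a ball of radius \<open>l * DIM('a)\<close>, whose five-fold enlargement lies in a
  cube of side \<open>10 * l * DIM('a)\<close>; the factor 2 stems from sets filling half of a cube.\<close>

definition covering_const :: "'a::euclidean_space itself \<Rightarrow> real" where
  "covering_const _ = 2 * (10 * DIM('a)) ^ DIM('a)"

text \<open>Each cube is put into a ball around its lower corner, and Vitali selects disjoint balls
  whose five-fold enlargements cover \<open>S\<close>. An enlarged ball is at most a constant times
  the part of \<open>G\<close> in its cube, and these parts are disjoint subsets of
  \<open>Q0\<close>.\<close>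

lemma emeasure_le_by_cube_covering:
  fixes S :: "'a::euclidean_space set"
  assumes Q0: "cube Q0" and G: "G \<in> sets lebesgue"
    and cov: "\<And>x. x \<in> S \<Longrightarrow>
      \<exists>Q. cube Q \<and> x \<in> Q \<and> Q \<subseteq> Q0 \<and> measure lebesgue Q \<le> 2 * measure lebesgue (Q \<inter> G)"
  shows "emeasure lebesgue S \<le> ennreal (covering_const TYPE('a)) * emeasure lebesgue (Q0 \<inter> G)"
proof -
  have "\<exists>b l. l > 0 \<and> x \<in> cbox b (b + l *\<^sub>R One) \<and> cbox b (b + l *\<^sub>R One) \<subseteq> Q0 \<and>
     l ^ DIM('a) \<le> 2 * measure lebesgue (cbox b (b + l *\<^sub>R One) \<inter> G)" if x: "x \<in> S" for x
  proof -
    obtain Q where Q: "cube Q" "x \<in> Q" "Q \<subseteq> Q0" "measure lebesgue Q \<le> 2 * measure lebesgue (Q \<inter> G)"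
      using cov[OF x] by blast
    obtain b l where "l > 0" "Q = cbox b (b + l *\<^sub>R One)"
      using Q(1) by (rule cubeE)
    then show ?thesis
      using Q measure_cube[of l b] by (intro exI[of _ b] exI[of _ l]) simp
  qed
  then obtain b l where bl: "\<And>x. x \<in> S \<Longrightarrow> l x > 0"
    "\<And>x. x \<in> S \<Longrightarrow> x \<in> cbox (b x) (b x + l x *\<^sub>R One)"
    "\<And>x. x \<in> S \<Longrightarrow> cbox (b x) (b x + l x *\<^sub>R One) \<subseteq> Q0"
    "\<And>x. x \<in> S \<Longrightarrow> l x ^ DIM('a) \<le> 2 * measure lebesgue (cbox (b x) (b x + l x *\<^sub>R One) \<inter> G)"
    by metis
  define Q where "Q x = cbox (b x) (b x + l x *\<^sub>R One)" for x
  define r where "r x = l x * DIM('a)" for x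
  obtain a0 l0 where Q0': "l0 > 0" "Q0 = cbox a0 (a0 + l0 *\<^sub>R One)"
    using Q0 by (rule cubeE)
  \<comment> \<open>Vitali's lemma requires a common bound on the radii.\<close>
  have lb: "l x \<le> l0" if "x \<in> S" for x
  proof -
    obtain i :: 'a where i: "i \<in> Basis" using nonempty_Basis by blast
    have "b x \<in> Q0" "b x + l x *\<^sub>R One \<in> Q0"
      using bl(1,3)[OF that] by (auto simp: subset_iff mem_box inner_add_left)
    then show ?thesis
      using i by (auto simp: Q0' mem_box inner_add_left dest!: bspec[of _ _ i])
  qed
  have QB: "Q x \<subseteq> cball (b x) (r x)" if "x \<in> S" for x
    unfolding Q_def r_def using bl(1)[OF that] by (intro cube_subset_cball) simp
  obtain C where C: "countable C" "C \<subseteq> S"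
    "pairwise (\<lambda>i j. disjnt (cball (b i) (r i)) (cball (b j) (r j))) C"
    "S \<subseteq> (\<Union>i\<in>C. cball (b i) (5 * r i))"
  proof (rule Vitali_covering_lemma_cballs)
    show "S \<subseteq> (\<Union>i\<in>S. cball (b i) (r i))"
      using QB bl(2) unfolding Q_def by blast
    show "0 < r i \<and> r i \<le> l0 * DIM('a)" if "i \<in> S" for i
      using bl(1)[OF that] lb[OF that] by (simp add: r_def)
  qed
  have disj: "disjoint_family_on (\<lambda>i. Q i \<inter> G) C"
    using C(3) QB C(2) unfolding disjoint_family_on_def pairwise_def disjnt_def by blast
  have QG: "Q i \<inter> G \<in> sets lebesgue" for i
    unfolding Q_def using G by auto
  have ball: "emeasure lebesgue (cball (b i) (5 * r i))
      \<le> ennreal (covering_const TYPE('a)) * emeasure lebesgue (Q i \<inter> G)" if "i \<in> C" for i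
  proof -
    have i: "i \<in> S" using that C(2) by blast
    let ?D = "real DIM('a)"
    have "emeasure lebesgue (cball (b i) (5 * r i)) \<le> ennreal ((2 * (5 * r i)) ^ DIM('a))"
      using emeasure_mono[OF cball_subset_cube[of "b i" "5 * r i"], of lebesgue] bl(1)[OF i]
      by (simp add: emeasure_cube r_def del: emeasure_completion)
    also have "(2 * (5 * r i)) ^ DIM('a) = (10 * ?D) ^ DIM('a) * l i ^ DIM('a)"
      unfolding r_def power_mult_distrib[symmetric] by (simp add: algebra_simps)
    also have "\<dots> \<le> (10 * ?D) ^ DIM('a) * (2 * measure lebesgue (Q i \<inter> G))"
      using bl(4)[OF i] by (intro mult_left_mono) (auto simp: Q_def)
    also have "\<dots> = covering_const TYPE('a) * measure lebesgue (Q i \<inter> G)"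
      by (simp add: covering_const_def)
    also have "ennreal \<dots> = ennreal (covering_const TYPE('a)) * emeasure lebesgue (Q i \<inter> G)"
    proof -
      have "Q i \<inter> G \<in> lmeasurable"
        unfolding Q_def using G by (simp add: fmeasurable_Int_fmeasurable)
      then show ?thesis
        by (simp add: emeasure_eq_measure2 ennreal_mult covering_const_def)
    qed
    finally show ?thesis
      using ennreal_leI by simp
  qed
  have "emeasure lebesgue S \<le> emeasure lebesgue (\<Union>i\<in>C. cball (b i) (5 * r i))"
    using C(1,4) by (intro emeasure_mono sets.countable_UN'') auto
  also have "\<dots> \<le> (\<integral>\<^sup>+i. emeasure lebesgue (cball (b i) (5 * r i)) \<partial>count_space C)"
    by (rule emeasure_UN_countable_le) (use C(1) in auto)
  also have "\<dots> \<le> (\<integral>\<^sup>+i. ennreal (covering_const TYPE('a)) * emeasure lebesgue (Q i \<inter> G) \<partial>count_space C)"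
    by (intro nn_integral_mono) (use ball in auto)
  also have "\<dots> = ennreal (covering_const TYPE('a)) * (\<integral>\<^sup>+i. emeasure lebesgue (Q i \<inter> G) \<partial>count_space C)"
    by (simp add: nn_integral_cmult)
  also have "(\<integral>\<^sup>+i. emeasure lebesgue (Q i \<inter> G) \<partial>count_space C) = emeasure lebesgue (\<Union>i\<in>C. Q i \<inter> G)"
    by (rule emeasure_UN_countable[symmetric]) (use C(1) QG disj in auto)
  also have "\<dots> \<le> emeasure lebesgue (Q0 \<inter> G)"
    using C(2) bl(3) G Q0' by (intro emeasure_mono) (auto simp: Q_def)
  finally show ?thesis
    by (simp add: mult_left_mono)
qed

section \<open>The John--Stromberg theorem at the critical level\<close>

lemma pred_sets_lebesgue: "Measurable.pred lebesgue P \<Longrightarrow> {x. P x} \<in> sets lebesgue"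
  by (simp add: pred_def)

text \<open>Almost every point of \<open>Q0\<close> with \<open>f x > k\<close> lies in a cube that
  \<open>{f \<le> k}\<close> splits in half. The strict inequality in \<open>osc\<close> forces the
  majority set of that cube to meet both halves, which ties its constant to \<open>k\<close> and
  yields the hypothesis of the covering estimate.\<close>

lemma emeasure_superlevel_le_layer:
  fixes f :: "'a::euclidean_space \<Rightarrow> real"
  assumes f: "f \<in> borel_measurable lebesgue"
    and osc: "\<And>Q. cube Q \<Longrightarrow> \<exists>c. measure lebesgue (Q \<inter> {x. \<bar>f x - c\<bar> \<le> 1}) > measure lebesgue Q / 2"
    and Q0: "cube Q0" and k: "measure lebesgue (Q0 \<inter> {x. f x \<le> k}) \<ge> measure lebesgue Q0 / 2"
  shows "emeasure lebesgue (Q0 \<inter> {x. k < f x})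
    \<le> ennreal (covering_const TYPE('a)) * emeasure lebesgue (Q0 \<inter> {x. \<bar>f x - k\<bar> \<le> 2})"
proof -
  define F where "F = {x. f x \<le> k}"
  define G where "G = {x. \<bar>f x - k\<bar> \<le> 2}"
  note f[measurable]
  have F: "F \<in> sets lebesgue" and G: "G \<in> sets lebesgue"
    unfolding F_def G_def by (intro pred_sets_lebesgue; measurable)+
  obtain N where N: "negligible N" and bal: "\<And>x. x \<in> Q0 - F - N \<Longrightarrow>
    \<exists>Q. cube Q \<and> x \<in> Q \<and> Q \<subseteq> Q0 \<and> measure lebesgue (Q \<inter> F) = measure lebesgue Q / 2"
    using balanced_cubes_almost_everywhere[OF F Q0] k unfolding F_def by blast
  have "emeasure lebesgue (Q0 - F - N) \<le> ennreal (covering_const TYPE('a)) * emeasure lebesgue (Q0 \<inter> G)"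
  proof (rule emeasure_le_by_cube_covering[OF Q0 G])
    fix x assume "x \<in> Q0 - F - N"
    then obtain Q where Q: "cube Q" "x \<in> Q" "Q \<subseteq> Q0" "measure lebesgue (Q \<inter> F) = measure lebesgue Q / 2"
      using bal by blast
    obtain c where c: "measure lebesgue (Q \<inter> {x. \<bar>f x - c\<bar> \<le> 1}) > measure lebesgue Q / 2"
      using osc[OF Q(1)] by blast
    define P where "P = Q \<inter> {x. \<bar>f x - c\<bar> \<le> 1}"
    have Qm: "Q \<in> lmeasurable" using Q(1) by (rule cube_lmeasurable)
    have "{x. \<bar>f x - c\<bar> \<le> 1} \<in> sets lebesgue" by (intro pred_sets_lebesgue) measurable
    then have Pm: "P \<in> lmeasurable" and QFm: "Q \<inter> F \<in> lmeasurable" and QGm: "Q \<inter> G \<in> lmeasurable"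
      using Qm F G by (simp_all add: P_def fmeasurable_Int_fmeasurable)
    \<comment> \<open>Otherwise \<open>P\<close> and \<open>Q \<inter> F\<close> would be disjoint
      subsets of \<open>Q\<close> of total measure above that of \<open>Q\<close>.\<close>
    have "\<exists>y\<in>P. f y \<le> k"
    proof (rule ccontr)
      assume "\<not> (\<exists>y\<in>P. f y \<le> k)"
      then have "P \<inter> (Q \<inter> F) = {}" by (auto simp: F_def)
      then have "measure lebesgue P + measure lebesgue (Q \<inter> F) = measure lebesgue (P \<union> (Q \<inter> F))"
        using Pm QFm by (simp add: measure_Un3)
      also have "\<dots> \<le> measure lebesgue Q"
        using Pm QFm Qm by (intro measure_mono_fmeasurable) (auto simp: P_def)
      finally show False using c Q(4) by (simp add: P_def)
    qed
    \<comment> \<open>Otherwise \<open>P\<close>, which is more than half of \<open>Q\<close>, would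
      fit into \<open>Q \<inter> F\<close>, which is exactly half.\<close>
    moreover have "\<exists>y\<in>P. k < f y"
    proof (rule ccontr)
      assume "\<not> (\<exists>y\<in>P. k < f y)"
      then have "P \<subseteq> Q \<inter> F" by (force simp: F_def P_def)
      then have "measure lebesgue P \<le> measure lebesgue (Q \<inter> F)"
        using Pm QFm by (intro measure_mono_fmeasurable) auto
      then show False using c Q(4) by (simp add: P_def)
    qed
    \<comment> \<open>The point with \<open>f y \<le> k\<close> gives \<open>c \<le> k + 1\<close>,
      the other one gives \<open>c \<ge> k - 1\<close>.\<close>
    ultimately have "\<bar>c - k\<bar> \<le> 1" by (force simp: P_def)
    then have "P \<subseteq> Q \<inter> G" by (auto simp: P_def G_def)
    then have "measure lebesgue P \<le> measure lebesgue (Q \<inter> G)"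
      using Pm QGm by (intro measure_mono_fmeasurable) auto
    then show "\<exists>Q. cube Q \<and> x \<in> Q \<and> Q \<subseteq> Q0 \<and> measure lebesgue Q \<le> 2 * measure lebesgue (Q \<inter> G)"
      using c Q by (intro exI[of _ Q]) (simp add: P_def)
  qed
  moreover have "emeasure lebesgue (Q0 - F - N) = emeasure lebesgue (Q0 - F)"
    using N F Q0 by (intro emeasure_Diff_null_set)
      (auto simp: negligible_iff_null_sets dest: cube_lmeasurable)
  moreover have "Q0 - F = Q0 \<inter> {x. k < f x}" by (auto simp: F_def)
  ultimately show ?thesis by (simp add: G_def)
qed

text \<open>The sum counts the natural numbers below \<open>y\<close>, which is \<open>y\<close>
  rounded up. For negative \<open>y\<close> both sides are 0, since \<open>ennreal\<close>
  truncates.\<close>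

lemma le_suminf_indicator_levels:
  "ennreal y \<le> (\<Sum>k::nat. indicator {x::real. real k < x} y)"
proof -
  have "ennreal y \<le> ennreal (real (nat \<lceil>y\<rceil>))"
    by (intro ennreal_leI) linarith
  also have "\<dots> = (\<Sum>k<nat \<lceil>y\<rceil>. 1)"
    by (simp add: ennreal_of_nat_eq_real_of_nat)
  also have "\<dots> = (\<Sum>k<nat \<lceil>y\<rceil>. indicator {x::real. real k < x} y)"
    by (intro sum.cong refl) (auto simp: indicator_def, linarith)
  also have "\<dots> \<le> (\<Sum>k::nat. indicator {x::real. real k < x} y)"
    by (intro sum_le_suminf) auto
  finally show ?thesis .
qed

lemma suminf_indicator_layers_le:
  "(\<Sum>k::nat. indicator {x::real. \<bar>x - real k\<bar> \<le> 2} y) \<le> (5::ennreal)"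
proof (rule suminf_le_const)
  fix n :: nat
  \<comment> \<open>The window of five integers starts here. If \<open>y < 2\<close>, then
    \<open>nat\<close> cuts the start off at 0, and \<open>k \<le> y + 2 < 4\<close> still lies in
    it.\<close>
  define m where "m = nat \<lceil>y - 2\<rceil>"
  have "(\<Sum>k<n. indicator {x::real. \<bar>x - real k\<bar> \<le> 2} y)
    = (of_nat (card {k\<in>{..<n}. \<bar>y - real k\<bar> \<le> 2}) :: ennreal)"
    by (simp add: indicator_def sum.If_cases Int_def)
  also have "\<dots> \<le> of_nat 5"
  proof (rule of_nat_mono)
    have "{k\<in>{..<n}. \<bar>y - real k\<bar> \<le> 2} \<subseteq> {m..<m + 5}"
      unfolding m_def by auto linarith+
    then show "card {k\<in>{..<n}. \<bar>y - real k\<bar> \<le> 2} \<le> 5"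
      using card_mono[of "{m..<m + 5}"] by fastforce
  qed
  finally show "(\<Sum>k<n. indicator {x::real. \<bar>x - real k\<bar> \<le> 2} y) \<le> (5::ennreal)"
    by simp
qed simp

text \<open>As \<open>ennreal\<close> sends negative reals to 0, the integrand is the positive part
  of \<open>f\<close>. It is bounded by the sum of its superlevel indicators; each level
  \<open>k \<ge> 1\<close> is controlled by the layer around \<open>k\<close>, and a point lies in
  at most five layers.\<close>

lemma nn_integral_positive_part_le:
  fixes f :: "'a::euclidean_space \<Rightarrow> real"
  assumes f: "f \<in> borel_measurable lebesgue"
    and osc: "\<And>Q. cube Q \<Longrightarrow> \<exists>c. measure lebesgue (Q \<inter> {x. \<bar>f x - c\<bar> \<le> 1}) > measure lebesgue Q / 2"
    and Q0: "cube Q0" and k: "measure lebesgue (Q0 \<inter> {x. \<bar>f x\<bar> \<le> 1}) > measure lebesgue Q0 / 2"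
  shows "(\<integral>\<^sup>+x. ennreal (f x) * indicator Q0 x \<partial>lebesgue)
    \<le> ennreal (1 + 5 * covering_const TYPE('a)) * emeasure lebesgue Q0"
proof -
  note f[measurable]
  let ?N = "ennreal (covering_const TYPE('a))"
  have Q0s[measurable]: "Q0 \<in> sets lebesgue" using cube_lmeasurable[OF Q0] by auto
  define U where "U k = Q0 \<inter> {x. real k < f x}" for k
  define V where "V k = Q0 \<inter> {x. \<bar>f x - real k\<bar> \<le> 2}" for k
  have UV[measurable]: "U k \<in> sets lebesgue" "V k \<in> sets lebesgue" for k
    unfolding U_def V_def by measurable
  \<comment> \<open>The bound \<open>\<bar>f\<bar> \<le> 1\<close> on more than half of
    \<open>Q0\<close> makes \<open>{f \<le> k}\<close> at least half of \<open>Q0\<close> only from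
    \<open>k = 1\<close> on, hence the successor.\<close>
  have U: "emeasure lebesgue (U (Suc n)) \<le> ?N * emeasure lebesgue (V (Suc n))" for n
    unfolding U_def V_def
  proof (rule emeasure_superlevel_le_layer[OF f osc Q0])
    have "measure lebesgue (Q0 \<inter> {x. \<bar>f x\<bar> \<le> 1}) \<le> measure lebesgue (Q0 \<inter> {x. f x \<le> real (Suc n)})"
    proof (rule measure_mono_fmeasurable)
      have "{x. f x \<le> real (Suc n)} \<in> sets lebesgue" by (intro pred_sets_lebesgue) measurable
      then show "Q0 \<inter> {x. f x \<le> real (Suc n)} \<in> lmeasurable"
        by (simp add: fmeasurable_Int_fmeasurable cube_lmeasurable[OF Q0])
    qed auto
    then show "measure lebesgue Q0 / 2 \<le> measure lebesgue (Q0 \<inter> {x. f x \<le> real (Suc n)})"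
      using k by simp
  qed
  have "(\<integral>\<^sup>+x. ennreal (f x) * indicator Q0 x \<partial>lebesgue) \<le> (\<integral>\<^sup>+x. (\<Sum>k. indicator (U k) x) \<partial>lebesgue)"
  proof (rule nn_integral_mono)
    fix x
    show "ennreal (f x) * indicator Q0 x \<le> (\<Sum>k. indicator (U k) x)"
      using le_suminf_indicator_levels[of "f x"] by (cases "x \<in> Q0") (auto simp: U_def indicator_def)
  qed
  also have "\<dots> = (\<Sum>k. emeasure lebesgue (U k))"
    by (subst nn_integral_suminf) (auto simp del: emeasure_completion)
  \<comment> \<open>Level 0 is bounded by all of \<open>Q0\<close>, which gives the summand 1 in the
    constant.\<close>
  also have "\<dots> = emeasure lebesgue (U 0) + (\<Sum>k. emeasure lebesgue (U (Suc k)))"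
    using suminf_offset[of "\<lambda>k. emeasure lebesgue (U k)" 1] by (simp add: add.commute)
  also have "\<dots> \<le> emeasure lebesgue Q0 + (\<Sum>k. ?N * emeasure lebesgue (V (Suc k)))"
    using U by (intro add_mono suminf_le emeasure_mono) (auto simp: U_def)
  also have "(\<Sum>k. ?N * emeasure lebesgue (V (Suc k))) = ?N * (\<Sum>k. emeasure lebesgue (V (Suc k)))"
    by simp
  also have "(\<Sum>k. emeasure lebesgue (V (Suc k))) \<le> (\<Sum>k. emeasure lebesgue (V k))"
    using suminf_offset[of "\<lambda>k. emeasure lebesgue (V k)" 1] by simp
  also have "(\<Sum>k. emeasure lebesgue (V k)) = (\<integral>\<^sup>+x. (\<Sum>k. indicator (V k) x) \<partial>lebesgue)"
    by (subst nn_integral_suminf) (auto simp del: emeasure_completion)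
  also have "\<dots> \<le> (\<integral>\<^sup>+x. 5 * indicator Q0 x \<partial>lebesgue)"
  proof (rule nn_integral_mono)
    fix x
    show "(\<Sum>k. indicator (V k) x) \<le> 5 * (indicator Q0 x :: ennreal)"
      using suminf_indicator_layers_le[of "f x"] by (cases "x \<in> Q0") (auto simp: V_def indicator_def)
  qed
  also have "\<dots> = 5 * emeasure lebesgue Q0"
    by (simp add: nn_integral_cmult)
  finally show ?thesis
    by (simp add: covering_const_def ennreal_plus ennreal_mult distrib_right mult.assoc mult.left_commute add_mono mult_left_mono)
qed

text \<open>The estimate for positive parts is applied to \<open>(f - c) / t\<close> and to its
  negative, where \<open>c\<close> is the majority constant of \<open>Q0\<close>; the two signs give
  the factor 2.\<close>

lemma Stromberg_half:
  fixes f :: "'a::euclidean_space \<Rightarrow> real"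
  assumes f: "f \<in> borel_measurable lebesgue" and lam: "0 < t"
    and osc: "\<And>Q. cube Q \<Longrightarrow> \<exists>c. measure lebesgue (Q \<inter> {x. \<bar>f x - c\<bar> \<le> t}) > measure lebesgue Q / 2"
    and Q0: "cube Q0"
  obtains c where "(\<integral>\<^sup>+x. ennreal \<bar>f x - c\<bar> * indicator Q0 x \<partial>lebesgue)
    \<le> ennreal (2 * (1 + 5 * covering_const TYPE('a)) * t) * emeasure lebesgue Q0"
proof -
  note f[measurable]
  have Q0s[measurable]: "Q0 \<in> sets lebesgue" using cube_lmeasurable[OF Q0] by auto
  let ?N = "1 + 5 * covering_const TYPE('a)"
  obtain c where c: "measure lebesgue (Q0 \<inter> {x. \<bar>f x - c\<bar> \<le> t}) > measure lebesgue Q0 / 2"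
    using osc[OF Q0] by blast
  define g where "g s x = s * (f x - c) / t" for s x
  have part: "(\<integral>\<^sup>+x. ennreal (g s x) * indicator Q0 x \<partial>lebesgue) \<le> ennreal ?N * emeasure lebesgue Q0"
    if s: "\<bar>s\<bar> = 1" for s
  proof (rule nn_integral_positive_part_le[OF _ _ Q0])
    show "g s \<in> borel_measurable lebesgue" unfolding g_def by measurable
    \<comment> \<open>A majority constant \<open>d\<close> of \<open>f\<close> at level
      \<open>t\<close> becomes \<open>s * (d - c) / t\<close> for \<open>g s\<close> at level 1, and
      0 when \<open>d = c\<close>.\<close>
    have resc: "\<bar>g s x - s * (d - c) / t\<bar> \<le> 1 \<longleftrightarrow> \<bar>f x - d\<bar> \<le> t" for x d
    proof -
      have "g s x - s * (d - c) / t = s * (f x - d) / t"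
        by (simp add: g_def diff_divide_distrib[symmetric] algebra_simps)
      then show ?thesis using s lam by (simp add: abs_mult)
    qed
    show "\<exists>c. measure lebesgue Q / 2 < measure lebesgue (Q \<inter> {x. \<bar>g s x - c\<bar> \<le> 1})" if Q: "cube Q" for Q
    proof -
      obtain d where "measure lebesgue (Q \<inter> {x. \<bar>f x - d\<bar> \<le> t}) > measure lebesgue Q / 2"
        using osc[OF Q] by blast
      then show ?thesis
        by (intro exI[of _ "s * (d - c) / t"]) (simp add: resc)
    qed
    show "measure lebesgue Q0 / 2 < measure lebesgue (Q0 \<inter> {x. \<bar>g s x\<bar> \<le> 1})"
      using c resc[of _ c] by simp
  qed
  have "(\<integral>\<^sup>+x. ennreal \<bar>f x - c\<bar> * indicator Q0 x \<partial>lebesgue)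
     = (\<integral>\<^sup>+x. ennreal t * (ennreal (g 1 x) * indicator Q0 x + ennreal (g (-1) x) * indicator Q0 x) \<partial>lebesgue)"
  proof (rule nn_integral_cong)
    fix x
    \<comment> \<open>At each point one of \<open>g 1 x\<close> and \<open>g (-1) x\<close> is
      nonpositive and is truncated to 0 by \<open>ennreal\<close>.\<close>
    have "ennreal \<bar>f x - c\<bar> = ennreal t * ennreal (g 1 x) + ennreal t * ennreal (g (-1) x)"
    proof (cases "f x \<ge> c")
      case True
      then have "g (-1) x \<le> 0" "ennreal t * ennreal (g 1 x) = ennreal (f x - c)"
        using lam by (auto simp: g_def field_simps simp flip: ennreal_mult)
      with True show ?thesis by (simp add: ennreal_neg)
    next
      case False
      then have "g 1 x \<le> 0" "ennreal t * ennreal (g (-1) x) = ennreal (c - f x)"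
        using lam by (auto simp: g_def field_simps simp flip: ennreal_mult)
      with False show ?thesis by (simp add: ennreal_neg)
    qed
    then show "ennreal \<bar>f x - c\<bar> * indicator Q0 x
        = ennreal t * (ennreal (g 1 x) * indicator Q0 x + ennreal (g (-1) x) * indicator Q0 x)"
      by (simp add: indicator_def distrib_left)
  qed
  also have "\<dots> = ennreal t * ((\<integral>\<^sup>+x. ennreal (g 1 x) * indicator Q0 x \<partial>lebesgue)
      + (\<integral>\<^sup>+x. ennreal (g (-1) x) * indicator Q0 x \<partial>lebesgue))"
    unfolding g_def by (simp add: nn_integral_cmult nn_integral_add)
  also have "\<dots> \<le> ennreal t * (ennreal ?N * emeasure lebesgue Q0 + ennreal ?N * emeasure lebesgue Q0)"
    by (intro mult_left_mono add_mono part) auto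
  also have "\<dots> = ennreal (2 * ?N * t) * emeasure lebesgue Q0"
  proof -
    have "ennreal (2 * ?N * t) = ennreal t * (ennreal ?N + ennreal ?N)"
      using lam by (simp add: covering_const_def algebra_simps flip: ennreal_mult ennreal_plus)
    then show ?thesis by (simp add: distrib_right mult.assoc)
  qed
  finally show thesis by (rule that)
qed

section \<open>Averages over cubes and bounds for the BMO seminorm\<close>

lemma set_integrable_const_cube:
  "cube Q \<Longrightarrow> set_integrable lebesgue Q (\<lambda>x. c :: real)"
  using cube_lmeasurable[of Q] by (auto simp: set_integrable_def fmeasurable_def)

lemma average_const: "cube Q \<Longrightarrow> average Q (\<lambda>x. c) = c"
  using cube_measure_pos[of Q] cube_lmeasurable[of Q]
  by (simp add: average_def set_lebesgue_integral_def)

lemma average_diff: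
  "\<lbrakk>set_integrable lebesgue Q f; set_integrable lebesgue Q g\<rbrakk> \<Longrightarrow>
    average Q (\<lambda>x. f x - g x) = average Q f - average Q g"
  by (simp add: average_def set_integral_diff diff_divide_distrib)

lemma average_add:
  "\<lbrakk>set_integrable lebesgue Q f; set_integrable lebesgue Q g\<rbrakk> \<Longrightarrow>
    average Q (\<lambda>x. f x + g x) = average Q f + average Q g"
  by (simp add: average_def set_integral_add add_divide_distrib)

lemma average_mono:
  "\<lbrakk>set_integrable lebesgue Q f; set_integrable lebesgue Q g; \<And>x. x \<in> Q \<Longrightarrow> f x \<le> g x\<rbrakk> \<Longrightarrow>
    average Q f \<le> average Q g"
  by (simp add: average_def divide_right_mono set_integral_mono)

lemma abs_average_le:
  assumes "set_integrable lebesgue Q f"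
  shows "\<bar>average Q f\<bar> \<le> average Q (\<lambda>x. \<bar>f x\<bar>)"
proof -
  have "\<bar>LINT x:Q|lebesgue. f x\<bar> \<le> (LINT x:Q|lebesgue. \<bar>f x\<bar>)"
    using set_integral_norm_bound[OF assms] by simp
  then show ?thesis by (simp add: average_def divide_right_mono)
qed

lemma locally_integrable_cube:
  "\<lbrakk>locally_integrable f; cube Q\<rbrakk> \<Longrightarrow> set_integrable lebesgue Q f"
  by (auto simp: locally_integrable_def elim!: cubeE)

lemma compact_subset_cube:
  fixes K :: "'a::euclidean_space set"
  assumes "compact K"
  obtains Q where "cube Q" "K \<subseteq> Q"
proof -
  obtain B where B: "B > 0" "K \<subseteq> cball 0 B"
    using compact_imp_bounded[OF assms] by (auto simp: bounded_pos subset_iff)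
  show thesis
  proof (rule that)
    show "cube (cbox (0 - B *\<^sub>R One) ((0 - B *\<^sub>R One) + (2 * B) *\<^sub>R (One :: 'a)))"
      unfolding cube_def using B(1)
      by (intro exI[of _ "0 - B *\<^sub>R One"] exI[of _ "2 * B"]) simp
  qed (use B(2) cball_subset_cube[of "0::'a" B] in blast)
qed

lemma locally_integrableI:
  assumes "\<And>Q. cube Q \<Longrightarrow> set_integrable lebesgue Q f"
  shows "locally_integrable f"
  unfolding locally_integrable_def
proof (intro allI impI)
  fix K :: "'a set" assume K: "compact K"
  then obtain Q where Q: "cube Q" "K \<subseteq> Q" by (rule compact_subset_cube)
  show "f absolutely_integrable_on K"
    using assms[OF Q(1)] lmeasurable_compact[OF K] Q(2) by (blast intro: set_integrable_subset)
qed

text \<open>The nonnegative integral is meaningful for any measurable \<open>f\<close>; its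
  finiteness yields integrability on \<open>Q\<close>, after which the bound carries over to the
  average.\<close>

lemma average_abs_diff_le:
  fixes f :: "'a::euclidean_space \<Rightarrow> real"
  assumes f: "f \<in> borel_measurable lebesgue" and Q: "cube Q" and D: "0 \<le> D"
    and le: "(\<integral>\<^sup>+x. ennreal \<bar>f x - c\<bar> * indicator Q x \<partial>lebesgue) \<le> ennreal D * emeasure lebesgue Q"
  shows "set_integrable lebesgue Q f" and "average Q (\<lambda>x. \<bar>f x - c\<bar>) \<le> D"
proof -
  note f[measurable]
  have Qm: "Q \<in> lmeasurable" using Q by (rule cube_lmeasurable)
  then have [measurable]: "Q \<in> sets lebesgue" by auto
  have le': "(\<integral>\<^sup>+x. ennreal (indicator Q x * \<bar>f x - c\<bar>) \<partial>lebesgue) \<le> ennreal (D * measure lebesgue Q)"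
  proof -
    have "(\<integral>\<^sup>+x. ennreal (indicator Q x * \<bar>f x - c\<bar>) \<partial>lebesgue)
        = (\<integral>\<^sup>+x. ennreal \<bar>f x - c\<bar> * indicator Q x \<partial>lebesgue)"
      by (intro nn_integral_cong) (auto simp: indicator_def)
    then show ?thesis using le D Qm by (simp add: emeasure_eq_measure2 ennreal_mult)
  qed
  have int: "set_integrable lebesgue Q (\<lambda>x. f x - c)"
    unfolding set_integrable_def
  proof (rule integrableI_bounded)
    show "(\<lambda>x. indicat_real Q x *\<^sub>R (f x - c)) \<in> borel_measurable lebesgue" by measurable
    show "(\<integral>\<^sup>+x. ennreal (norm (indicat_real Q x *\<^sub>R (f x - c))) \<partial>lebesgue) < \<infinity>"
      using le' by (auto simp: abs_mult intro: le_less_trans)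
  qed
  show "set_integrable lebesgue Q f"
    using set_integral_add(1)[OF int set_integrable_const_cube[OF Q, of c]] by simp
  have "ennreal (LINT x:Q|lebesgue. \<bar>f x - c\<bar>) = (\<integral>\<^sup>+x. ennreal (indicator Q x * \<bar>f x - c\<bar>) \<partial>lebesgue)"
    unfolding set_lebesgue_integral_def
    using set_integrable_abs[OF int] by (subst nn_integral_eq_integral) (auto simp: set_integrable_def)
  with le' have "ennreal (LINT x:Q|lebesgue. \<bar>f x - c\<bar>) \<le> ennreal (D * measure lebesgue Q)"
    by (rule ord_eq_le_trans[rotated])
  then have "(LINT x:Q|lebesgue. \<bar>f x - c\<bar>) \<le> D * measure lebesgue Q"
    by (subst (asm) ennreal_le_iff) (simp_all add: D)
  then show "average Q (\<lambda>x. \<bar>f x - c\<bar>) \<le> D"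
    using cube_measure_pos[OF Q] by (simp add: average_def divide_le_eq)
qed

text \<open>Replacing \<open>c\<close> by the mean of \<open>f\<close> costs the distance between
  the two, which is again at most \<open>D\<close>; hence the factor 2.\<close>

lemma bmo_norm_le:
  assumes f: "locally_integrable f"
    and D: "\<And>Q. cube Q \<Longrightarrow> \<exists>c. average Q (\<lambda>x. \<bar>f x - c\<bar>) \<le> D"
  shows "bmo_norm f \<le> ennreal (2 * D)"
  unfolding bmo_norm_def
proof (rule SUP_least, rule ennreal_leI)
  fix Q :: "'a set" assume "Q \<in> {Q. cube Q}"
  then have Q: "cube Q" by simp
  then obtain c where c: "average Q (\<lambda>x. \<bar>f x - c\<bar>) \<le> D" using D by blast
  let ?m = "average Q f"
  have fi: "set_integrable lebesgue Q f" using f Q by (rule locally_integrable_cube)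
  have int: "set_integrable lebesgue Q (\<lambda>x. f x - d)" for d
    by (intro set_integral_diff(1) fi set_integrable_const_cube Q)
  have "\<bar>?m - c\<bar> = \<bar>average Q (\<lambda>x. f x - c)\<bar>"
    by (simp add: average_diff[OF fi set_integrable_const_cube[OF Q]] average_const[OF Q])
  also have "\<dots> \<le> D" using abs_average_le[OF int] c by (rule order_trans)
  finally have mc: "\<bar>?m - c\<bar> \<le> D" .
  have "average Q (\<lambda>x. \<bar>f x - ?m\<bar>) \<le> average Q (\<lambda>x. \<bar>f x - c\<bar> + \<bar>?m - c\<bar>)"
    by (intro average_mono set_integral_add(1) set_integrable_abs int set_integrable_const_cube Q) linarith
  also have "\<dots> = average Q (\<lambda>x. \<bar>f x - c\<bar>) + \<bar>?m - c\<bar>"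
    by (simp add: average_add[OF set_integrable_abs[OF int] set_integrable_const_cube[OF Q]] average_const[OF Q])
  finally show "average Q (\<lambda>x. \<bar>f x - ?m\<bar>) \<le> 2 * D" using c mc by simp
qed

lemma Stromberg_half_bmo:
  fixes f :: "'a::euclidean_space \<Rightarrow> real"
  assumes f: "f \<in> borel_measurable lebesgue" and t: "0 < t"
    and osc: "\<And>Q. cube Q \<Longrightarrow> \<exists>c. measure lebesgue (Q \<inter> {x. \<bar>f x - c\<bar> \<le> t}) > measure lebesgue Q / 2"
  shows "locally_integrable f"
    and "bmo_norm f \<le> ennreal (4 * (1 + 5 * covering_const TYPE('a)) * t)"
proof -
  let ?D = "2 * (1 + 5 * covering_const TYPE('a)) * t"
  have D: "0 \<le> ?D" using t by (simp add: covering_const_def)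
  have *: "\<exists>c. set_integrable lebesgue Q f \<and> average Q (\<lambda>x. \<bar>f x - c\<bar>) \<le> ?D" if Q: "cube Q" for Q
  proof -
    obtain c where "(\<integral>\<^sup>+x. ennreal \<bar>f x - c\<bar> * indicator Q x \<partial>lebesgue) \<le> ennreal ?D * emeasure lebesgue Q"
      using f t osc Q by (rule Stromberg_half)
    from average_abs_diff_le[OF f Q D this] show ?thesis by blast
  qed
  then show "locally_integrable f" by (blast intro: locally_integrableI)
  moreover have "\<And>Q. cube Q \<Longrightarrow> \<exists>c. average Q (\<lambda>x. \<bar>f x - c\<bar>) \<le> ?D" using * by blast
  ultimately have "bmo_norm f \<le> ennreal (2 * ?D)" by (rule bmo_norm_le)
  then show "bmo_norm f \<le> ennreal (4 * (1 + 5 * covering_const TYPE('a)) * t)" by (simp add: algebra_simps)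
qed

section \<open>Quasi-Banach function spaces\<close>

lemma qbfs_ideal:
  assumes "quasi_banach_fs Q S"
  shows "\<forall>f\<in>members S. \<forall>g\<in>borel_measurable (lebesgue_on Q).
    (AE x in lebesgue_on Q. \<bar>g x\<bar> \<le> \<bar>f x\<bar>) \<longrightarrow> g \<in> members S"
  using assms unfolding quasi_banach_fs_def order_ideal_on_def by (elim conjE) assumption

lemma qbfs_scale_mem:
  assumes "quasi_banach_fs Q S" "f \<in> members S"
  shows "(\<lambda>x. r * f x) \<in> members S"
proof -
  have "\<forall>f\<in>members S. \<forall>r. (\<lambda>x. r * f x) \<in> members S"
    using assms(1) unfolding quasi_banach_fs_def order_ideal_on_def by (elim conjE) assumption
  from bspec[OF this assms(2)] show ?thesis by (rule spec)
qed

lemma qbfs_add_mem: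
  assumes "quasi_banach_fs Q S" "f \<in> members S" "g \<in> members S"
  shows "(\<lambda>x. f x + g x) \<in> members S"
proof -
  have "\<forall>f\<in>members S. \<forall>g\<in>members S. (\<lambda>x. f x + g x) \<in> members S"
    using assms(1) unfolding quasi_banach_fs_def order_ideal_on_def by (elim conjE) assumption
  from bspec[OF bspec[OF this assms(2)] assms(3)] show ?thesis .
qed

lemma qnorm_mono:
  assumes "quasi_banach_fs Q S" "f \<in> members S" "g \<in> members S"
    "AE x in lebesgue_on Q. \<bar>f x\<bar> \<le> \<bar>g x\<bar>"
  shows "qnorm S f \<le> qnorm S g"
proof -
  have "\<forall>f\<in>members S. \<forall>g\<in>members S.
      (AE x in lebesgue_on Q. \<bar>f x\<bar> \<le> \<bar>g x\<bar>) \<longrightarrow> qnorm S f \<le> qnorm S g"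
    using assms(1) unfolding quasi_banach_fs_def by (elim conjE) assumption
  from mp[OF bspec[OF bspec[OF this assms(2)] assms(3)] assms(4)] show ?thesis .
qed

lemma qnorm_nonneg:
  assumes "quasi_banach_fs Q S" "f \<in> members S"
  shows "0 \<le> qnorm S f"
proof -
  have "\<forall>f\<in>members S. 0 \<le> qnorm S f"
    using assms(1) unfolding quasi_banach_fs_def quasi_norm_on_def by (elim conjE) assumption
  from bspec[OF this assms(2)] show ?thesis .
qed

lemma qnorm_scale:
  assumes "quasi_banach_fs Q S" "f \<in> members S"
  shows "qnorm S (\<lambda>x. r * f x) = \<bar>r\<bar> * qnorm S f"
proof -
  have "\<forall>f\<in>members S. \<forall>r. qnorm S (\<lambda>x. r * f x) = \<bar>r\<bar> * qnorm S f"
    using assms(1) unfolding quasi_banach_fs_def quasi_norm_on_def by (elim conjE) assumption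
  from bspec[OF this assms(2)] show ?thesis by (rule spec)
qed

section \<open>Extended quasi-norms and the two sufficient conditions\<close>

lemma ext_qnorm_mono:
  assumes S: "quasi_banach_fs Q S" and f: "f \<in> borel_measurable (lebesgue_on Q)"
    and le: "AE x in lebesgue_on Q. \<bar>f x\<bar> \<le> \<bar>g x\<bar>"
  shows "ext_qnorm S f \<le> ext_qnorm S g"
proof (cases "g \<in> members S")
  case True
  have fm: "f \<in> members S"
    using mp[OF bspec[OF bspec[OF qbfs_ideal[OF S] True] f] le] .
  from qnorm_mono[OF S fm True le] fm True show ?thesis
    by (simp add: ext_qnorm_def ennreal_leI)
qed (simp add: ext_qnorm_def)

lemma ext_qnorm_le_realD:
  "ext_qnorm S f \<le> ennreal M \<Longrightarrow> 0 \<le> M \<Longrightarrow> f \<in> members S \<and> qnorm S f \<le> M"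
  by (auto simp: ext_qnorm_def top_unique split: if_splits)

text \<open>A bound \<open>M\<close> strictly above the seminorm provides a centre on each cube
  without the infimum being attained. The estimates below are therefore stated for all such
  \<open>M\<close>.\<close>

lemma bmoX_star_less_imp_centre:
  assumes "bmoX_star_norm X f < ennreal M" "cube Q"
  obtains c where "ext_qnorm (X Q) (\<lambda>x. f x - c) < ennreal M"
proof -
  have "(INF c. ext_qnorm (X Q) (\<lambda>x. f x - c)) \<le> bmoX_star_norm X f"
    unfolding bmoX_star_norm_def using assms(2) by (intro SUP_upper) simp
  with assms(1) have "(INF c. ext_qnorm (X Q) (\<lambda>x. f x - c)) < ennreal M" by (rule le_less_trans[rotated])
  then show thesis using that by (auto simp: INF_less_iff)
qed

text \<open>A Chebyshev argument: if \<open>\<bar>f - d\<bar>\<close> exceeded \<open>M / c\<close>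
  on at least half of \<open>Q\<close>, then by monotonicity and homogeneity the quasi-norm of
  \<open>f - d\<close> would be at least \<open>M / c * c = M\<close>. So the half-measure
  oscillation condition holds at level \<open>t = M / c\<close>.\<close>

lemma bmo_of_large_sets_large_norm:
  fixes f :: "'a::euclidean_space \<Rightarrow> real"
  assumes X: "\<And>Q. cube Q \<Longrightarrow> quasi_banach_fs Q (X Q)" and c: "c > 0"
    and large: "\<And>Q E. \<lbrakk>cube Q; E \<in> sets lebesgue; E \<subseteq> Q; measure lebesgue E \<ge> measure lebesgue Q / 2\<rbrakk>
      \<Longrightarrow> ext_qnorm (X Q) (indicat_real E) \<ge> ennreal c"
    and f: "f \<in> borel_measurable lebesgue" and M: "0 < M" "bmoX_star_norm X f < ennreal M"
  shows "locally_integrable f"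
    and "bmo_norm f \<le> ennreal (4 * (1 + 5 * covering_const TYPE('a)) / c * M)"
proof -
  note f[measurable]
  have t: "0 < M / c" using M c by simp
  have osc: "\<exists>d. measure lebesgue (Q \<inter> {x. \<bar>f x - d\<bar> \<le> M / c}) > measure lebesgue Q / 2"
    if Q: "cube Q" for Q
  proof -
    obtain d where d: "ext_qnorm (X Q) (\<lambda>x. f x - d) < ennreal M"
      using M(2) Q by (rule bmoX_star_less_imp_centre)
    define E where "E = Q \<inter> {x. M / c < \<bar>f x - d\<bar>}"
    have Qm: "Q \<in> lmeasurable" using Q by (rule cube_lmeasurable)
    have sets: "{x. M / c < \<bar>f x - d\<bar>} \<in> sets lebesgue" "{x. \<bar>f x - d\<bar> \<le> M / c} \<in> sets lebesgue"
      by (intro pred_sets_lebesgue; measurable)+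
    have Em: "E \<in> lmeasurable" "Q \<inter> {x. \<bar>f x - d\<bar> \<le> M / c} \<in> lmeasurable"
      unfolding E_def using sets Qm by (simp_all add: fmeasurable_Int_fmeasurable)
    have "measure lebesgue E < measure lebesgue Q / 2"
    proof (rule ccontr)
      assume "\<not> ?thesis"
      then have lower: "ext_qnorm (X Q) (indicat_real E) \<ge> ennreal c"
        using Q Em by (intro large) (auto simp: E_def)
      have "(\<lambda>x. M / c * indicat_real E x) \<in> borel_measurable lebesgue"
        using Em(1) by measurable
      then have "ext_qnorm (X Q) (\<lambda>x. M / c * indicat_real E x) \<le> ext_qnorm (X Q) (\<lambda>x. f x - d)"
        using t by (intro ext_qnorm_mono[OF X[OF Q]] measurable_restrict_space1)
          (auto simp: E_def indicator_def)
      with d have "ext_qnorm (X Q) (\<lambda>x. M / c * indicat_real E x) < ennreal M" by simp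
      then have mem: "(\<lambda>x. M / c * indicat_real E x) \<in> members (X Q)"
        and less: "qnorm (X Q) (\<lambda>x. M / c * indicat_real E x) < M"
        using M(1) by (auto simp: ext_qnorm_def ennreal_less_iff split: if_splits)
          (metis ennreal_less_iff ennreal_neg linorder_le_less_linear not_less_iff_gr_or_eq order_le_less_trans)
      \<comment> \<open>Rescaling shows that the indicator itself is a member, so that its extended
        quasi-norm is a real number.\<close>
      have "(\<lambda>x. c / M * (M / c * indicat_real E x)) \<in> members (X Q)"
        by (rule qbfs_scale_mem[OF X[OF Q] mem])
      then have memE: "indicat_real E \<in> members (X Q)"
        using M c by simp
      then have "c \<le> qnorm (X Q) (indicat_real E)"
        using lower qnorm_nonneg[OF X[OF Q] memE] by (simp add: ext_qnorm_def ennreal_le_iff)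
      moreover have "qnorm (X Q) (\<lambda>x. M / c * indicat_real E x) = M / c * qnorm (X Q) (indicat_real E)"
        using qnorm_scale[OF X[OF Q] memE, of "M / c"] M c by simp
      moreover have "M = M / c * c" using c by simp
      ultimately have "M \<le> qnorm (X Q) (\<lambda>x. M / c * indicat_real E x)"
        using t by (metis mult_left_mono less_imp_le)
      with less show False by simp
    qed
    moreover have "measure lebesgue Q = measure lebesgue E + measure lebesgue (Q \<inter> {x. \<bar>f x - d\<bar> \<le> M / c})"
    proof -
      have "Q = E \<union> (Q \<inter> {x. \<bar>f x - d\<bar> \<le> M / c})" "E \<inter> (Q \<inter> {x. \<bar>f x - d\<bar> \<le> M / c}) = {}"
        by (auto simp: E_def)
      then show ?thesis using measure_Un3[OF Em] by simp
    qed
    ultimately show ?thesis by (intro exI[of _ d]) linarith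
  qed
  show "locally_integrable f" using f t osc by (rule Stromberg_half_bmo)
  show "bmo_norm f \<le> ennreal (4 * (1 + 5 * covering_const TYPE('a)) / c * M)"
    using Stromberg_half_bmo(2)[OF f t osc] by simp
qed

text \<open>The mean of \<open>\<bar>f - c\<bar>\<close> over \<open>Q\<close> is itself an
  oscillation bound for \<open>f\<close>, so it suffices to bound this constant. Its quasi-norm is
  at most \<open>K * (M + B * M)\<close>, and the normalization turns this into a bound on its value
  by division by \<open>a\<close>; \<open>bmo_norm_le\<close> contributes the factor 2.\<close>

lemma bmo_of_BMOX_star_eq_BMOX:
  fixes f :: "'a::euclidean_space \<Rightarrow> real"
  assumes X: "\<And>Q. cube Q \<Longrightarrow> quasi_banach_fs Q (X Q)"
    and a: "0 < a" "\<And>Q. cube Q \<Longrightarrow> ennreal a \<le> ext_qnorm (X Q) (indicat_real Q)"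
    and ind: "\<And>Q. cube Q \<Longrightarrow> indicat_real Q \<in> members (X Q)"
    and K: "0 \<le> K" "\<And>Q. cube Q \<Longrightarrow> quasi_triangle K (X Q)"
    and eq: "BMOX_star X = BMOX X" and B: "B > 0"
    and normB: "\<And>f. f \<in> BMOX X \<Longrightarrow> bmoX_norm X f \<le> ennreal B * bmoX_star_norm X f"
    and f: "f \<in> BMOX_star X" and M: "0 < M" "bmoX_star_norm X f < ennreal M"
  shows "bmo_norm f \<le> ennreal (2 * K * (B + 1) / a * M)"
proof -
  have f_int: "locally_integrable f" using f eq by (simp add: BMOX_def)
  have f_meas[measurable]: "f \<in> borel_measurable lebesgue" using f by (simp add: BMOX_star_def)
  have "\<exists>c. average Q (\<lambda>x. \<bar>f x - c\<bar>) \<le> K * (B + 1) / a * M" if Q: "cube Q" for Q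
  proof -
    obtain c where c: "ext_qnorm (X Q) (\<lambda>x. f x - c) < ennreal M"
      using M(2) Q by (rule bmoX_star_less_imp_centre)
    define g where "g x = \<bar>f x - c\<bar>" for x
    have g_meas[measurable]: "g \<in> borel_measurable lebesgue" unfolding g_def by measurable
    have star_le: "bmoX_star_norm X g \<le> bmoX_star_norm X f"
      unfolding bmoX_star_norm_def
    proof (rule SUP_mono, intro bexI)
      fix R :: "'a set" assume R: "R \<in> {Q. cube Q}"
      show "R \<in> {Q. cube Q}" by fact
      show "(INF d. ext_qnorm (X R) (\<lambda>x. g x - d)) \<le> (INF d. ext_qnorm (X R) (\<lambda>x. f x - d))"
      proof (rule INF_greatest)
        fix d
        \<comment> \<open>If \<open>d\<close> is a candidate centre for \<open>f\<close>, then
          \<open>\<bar>d - c\<bar>\<close> is at least as good for \<open>g\<close>, by the reverse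
          triangle inequality.\<close>
        have "(\<lambda>x. g x - \<bar>d - c\<bar>) \<in> borel_measurable (lebesgue_on R)"
          by (intro measurable_restrict_space1) measurable
        then have "ext_qnorm (X R) (\<lambda>x. g x - \<bar>d - c\<bar>) \<le> ext_qnorm (X R) (\<lambda>x. f x - d)"
          using X R by (intro ext_qnorm_mono) (auto simp: g_def)
        then show "(INF d. ext_qnorm (X R) (\<lambda>x. g x - d)) \<le> ext_qnorm (X R) (\<lambda>x. f x - d)"
          by (rule INF_lower2[OF UNIV_I])
      qed
    qed
    from this M(2) have star_less: "bmoX_star_norm X g < ennreal M" by (rule le_less_trans)
    then have "bmoX_star_norm X g < \<infinity>" by (rule less_trans) simp
    with g_meas have g_in: "g \<in> BMOX X" unfolding eq[symmetric] by (simp add: BMOX_star_def)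
    let ?m = "average Q g"
    have "ext_qnorm (X Q) (\<lambda>x. g x - ?m) \<le> bmoX_norm X g"
      unfolding bmoX_norm_def using Q by (intro SUP_upper) simp
    also have "\<dots> \<le> ennreal B * ennreal M"
      using normB[OF g_in] star_less by (meson less_imp_le mult_left_mono order_trans zero_le)
    also have "\<dots> = ennreal (B * M)" using B M by (simp add: ennreal_mult)
    finally have gm: "(\<lambda>x. g x - ?m) \<in> members (X Q)" "qnorm (X Q) (\<lambda>x. g x - ?m) \<le> B * M"
      using ext_qnorm_le_realD[of "X Q" "\<lambda>x. g x - ?m" "B * M"] B M by auto
    have "ext_qnorm (X Q) g \<le> ext_qnorm (X Q) (\<lambda>x. f x - c)"
      by (intro ext_qnorm_mono[OF X[OF Q]] measurable_restrict_space1) (auto simp: g_def)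
    then have g: "g \<in> members (X Q)" "qnorm (X Q) g \<le> M"
      using ext_qnorm_le_realD[of "X Q" g M] c M by auto
    \<comment> \<open>The constant \<open>?m\<close> is written as \<open>g - (g - ?m)\<close>, a
      sum of two members of controlled quasi-norm.\<close>
    have neg: "(\<lambda>x. -1 * (g x - ?m)) \<in> members (X Q)"
      by (rule qbfs_scale_mem[OF X[OF Q] gm(1)])
    have "qnorm (X Q) (\<lambda>x. g x + -1 * (g x - ?m)) \<le> K * (qnorm (X Q) g + qnorm (X Q) (\<lambda>x. -1 * (g x - ?m)))"
      using bspec[OF bspec[OF K(2)[OF Q, unfolded quasi_triangle_def] g(1)] neg] .
    also have "\<dots> \<le> K * (M + B * M)"
      using K(1) g(2) gm(2) qnorm_scale[OF X[OF Q] gm(1), of "-1"] by (intro mult_left_mono add_mono) auto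
    finally have upper: "qnorm (X Q) (\<lambda>x. ?m) \<le> K * (M + B * M)" by simp
    have const_mem: "(\<lambda>x. ?m) \<in> members (X Q)"
    proof -
      have "(\<lambda>x. g x + -1 * (g x - ?m)) \<in> members (X Q)"
        by (rule qbfs_add_mem[OF X[OF Q] g(1) neg])
      then show ?thesis by simp
    qed
    \<comment> \<open>The normalization concerns the indicator of \<open>Q\<close>, so the constant
      function is compared with this multiple of it.\<close>
    have ind_mem: "(\<lambda>x. ?m * indicat_real Q x) \<in> members (X Q)"
      by (rule qbfs_scale_mem[OF X[OF Q] ind[OF Q]])
    have "a \<le> qnorm (X Q) (indicat_real Q)"
      using a(2)[OF Q] ind[OF Q] qnorm_nonneg[OF X[OF Q] ind[OF Q]]
      by (simp add: ext_qnorm_def ennreal_le_iff)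
    then have "\<bar>?m\<bar> * a \<le> \<bar>?m\<bar> * qnorm (X Q) (indicat_real Q)"
      by (rule mult_left_mono) simp
    also have "\<dots> = qnorm (X Q) (\<lambda>x. ?m * indicat_real Q x)"
      using qnorm_scale[OF X[OF Q] ind[OF Q]] by simp
    also have "\<dots> \<le> qnorm (X Q) (\<lambda>x. ?m)"
    proof -
      have "AE x in lebesgue_on Q. \<bar>?m * indicat_real Q x\<bar> \<le> \<bar>?m\<bar>"
        by (simp add: indicator_def)
      then show ?thesis
        by (intro qnorm_mono[OF X[OF Q] ind_mem const_mem])
    qed
    finally have "\<bar>?m\<bar> * a \<le> K * (M + B * M)" using upper by linarith
    then have "?m * a \<le> K * (M + B * M)"
      using a(1) by (meson abs_ge_self mult_right_mono less_imp_le order_trans)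
    then have "?m \<le> K * (B + 1) / a * M"
      using a(1) by (simp add: field_simps)
    then show ?thesis unfolding g_def by blast
  qed
  from bmo_norm_le[OF f_int this] show ?thesis by (simp add: mult.assoc)
qed

text \<open>Letting \<open>M\<close> decrease to \<open>y\<close> removes the slack that the choice
  of centres introduced.\<close>

lemma ennreal_le_mult_of_all_greater:
  fixes x y :: ennreal
  assumes "0 \<le> C" "y < \<infinity>" "\<And>M. \<lbrakk>0 < M; y < ennreal M\<rbrakk> \<Longrightarrow> x \<le> ennreal (C * M)"
  shows "x \<le> ennreal C * y"
proof -
  obtain r where r: "y = ennreal r" "r \<ge> 0" using assms(2) by (cases y) auto
  have "x \<le> ennreal (C * r) + ennreal e" if e: "e > 0" for e
  proof -
    \<comment> \<open>The denominator \<open>C + 1\<close> keeps the increment positive and finite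
      also for \<open>C = 0\<close>, and \<open>C * e / (C + 1) \<le> e\<close>.\<close>
    have "x \<le> ennreal (C * (r + e / (C + 1)))"
      using assms(1) r e by (intro assms(3)) (auto simp: ennreal_less_iff add_nonneg_pos)
    also have "C * (r + e / (C + 1)) \<le> C * r + e"
      using assms(1) e by (simp add: distrib_left) (simp add: field_simps)
    finally show ?thesis
      using assms(1) r e by (simp add: ennreal_leI flip: ennreal_plus)
  qed
  then have "x \<le> ennreal (C * r)" by (rule ennreal_le_epsilon)
  then show ?thesis using r assms(1) by (simp add: ennreal_mult)
qed

section \<open>The embedding into BMO under either condition\<close>

theorem theorem1p2:
  fixes X :: "(real ^ 'n) set \<Rightarrow> (real ^ 'n) fspace"
  assumes "normalized_qbfs_family X"
    and "(\<exists>c>0. \<forall>Q E. cube Q \<and> E \<in> sets lebesgue \<and> E \<subseteq> Q \<and>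
              measure lebesgue E \<ge> 1/2 * measure lebesgue Q
              \<longrightarrow> ext_qnorm (X Q) (indicat_real E) \<ge> ennreal c)
       \<or> (uniform_quasi_triangle X \<and>
          BMOX_star X = BMOX X \<and>
          (\<exists>A>0. \<exists>B>0. \<forall>f\<in>BMOX X.
              bmoX_star_norm X f \<le> ennreal A * bmoX_norm X f \<and>
              bmoX_norm X f \<le> ennreal B * bmoX_star_norm X f))"
  shows "BMOX_star X \<subseteq> BMO \<and>
         (\<exists>C>0. \<forall>f\<in>BMOX_star X. bmo_norm f \<le> ennreal C * bmoX_star_norm X f)"
proof -
  have X: "quasi_banach_fs Q (X Q)" if "cube Q" for Q
    using assms(1) that by (simp add: normalized_qbfs_family_def)
  \<comment> \<open>Both conditions are reduced to this form, with a bound for every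
    \<open>M\<close> above the seminorm; this also covers functions of seminorm 0.\<close>
  have "\<exists>C>0. \<forall>f\<in>BMOX_star X. locally_integrable f \<and>
      (\<forall>M>0. bmoX_star_norm X f < ennreal M \<longrightarrow> bmo_norm f \<le> ennreal (C * M))"
    using assms(2)
  proof (elim disjE exE conjE)
    fix c :: real
    assume c: "c > 0" and *: "\<forall>Q E. cube Q \<and> E \<in> sets lebesgue \<and> E \<subseteq> Q \<and>
              measure lebesgue E \<ge> 1/2 * measure lebesgue Q
              \<longrightarrow> ext_qnorm (X Q) (indicat_real E) \<ge> ennreal c"
    let ?C = "4 * (1 + 5 * covering_const TYPE(real ^ 'n)) / c"
    have large: "ext_qnorm (X Q) (indicat_real E) \<ge> ennreal c"
      if "cube Q" "E \<in> sets lebesgue" "E \<subseteq> Q" "measure lebesgue E \<ge> measure lebesgue Q / 2" for Q E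
      using * that by simp
    show ?thesis
    proof (intro exI[of _ ?C] conjI ballI allI impI)
      show "?C > 0" using c by (auto simp: covering_const_def intro!: divide_pos_pos add_pos_nonneg)
      fix f assume "f \<in> BMOX_star X"
      then have f: "f \<in> borel_measurable lebesgue" "bmoX_star_norm X f < \<infinity>"
        by (auto simp: BMOX_star_def)
      show "locally_integrable f"
      proof -
        obtain r where "bmoX_star_norm X f = ennreal r" "r \<ge> 0"
          using f(2) by (cases "bmoX_star_norm X f") auto
        then have "0 < r + 1" "bmoX_star_norm X f < ennreal (r + 1)"
          by (auto simp: ennreal_less_iff)
        then show ?thesis
          using bmo_of_large_sets_large_norm(1)[OF X c large f(1)] by blast
      qed
      show "bmo_norm f \<le> ennreal (?C * M)" if "M > 0" "bmoX_star_norm X f < ennreal M" for M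
        using bmo_of_large_sets_large_norm(2)[OF X c large f(1) that] by blast
    qed
  next
    fix A B :: real
    assume unif: "uniform_quasi_triangle X" and eq: "BMOX_star X = BMOX X" and B: "B > 0"
      and norms: "\<forall>f\<in>BMOX X. bmoX_star_norm X f \<le> ennreal A * bmoX_norm X f \<and>
              bmoX_norm X f \<le> ennreal B * bmoX_star_norm X f"
    obtain a b where a: "0 < a" and ab: "\<And>Q. cube Q \<Longrightarrow> ennreal a \<le> ext_qnorm (X Q) (indicat_real Q)"
      "\<And>Q. cube Q \<Longrightarrow> ext_qnorm (X Q) (indicat_real Q) \<le> ennreal b"
      using assms(1) unfolding normalized_qbfs_family_def by blast
    \<comment> \<open>The upper normalization bound is finite, whereas \<open>ext_qnorm\<close> is
      infinite at non-members.\<close>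
    have ind: "indicat_real Q \<in> members (X Q)" if "cube Q" for Q
      using ab(2)[OF that] by (auto simp: ext_qnorm_def top_unique split: if_splits)
    obtain K0 where K0: "\<And>Q. cube Q \<Longrightarrow> quasi_triangle K0 (X Q)"
      using unif unfolding uniform_quasi_triangle_def by blast
    \<comment> \<open>Nothing is known about the sign of \<open>K0\<close>; the maximum makes the
      final constant positive, and enlarging the constant is harmless as quasi-norms are
      nonnegative.\<close>
    define K where "K = max K0 1"
    have K: "quasi_triangle K (X Q)" if "cube Q" for Q
      unfolding quasi_triangle_def
    proof (intro ballI)
      fix f g assume fg: "f \<in> members (X Q)" "g \<in> members (X Q)"
      then have "qnorm (X Q) (\<lambda>x. f x + g x) \<le> K0 * (qnorm (X Q) f + qnorm (X Q) g)"
        using K0[OF that] by (simp add: quasi_triangle_def)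
      also have "\<dots> \<le> K * (qnorm (X Q) f + qnorm (X Q) g)"
        using qnorm_nonneg[OF X[OF that]] fg by (intro mult_right_mono) (auto simp: K_def)
      finally show "qnorm (X Q) (\<lambda>x. f x + g x) \<le> K * (qnorm (X Q) f + qnorm (X Q) g)" .
    qed
    let ?C = "2 * K * (B + 1) / a"
    have K1: "0 \<le> K" by (simp add: K_def)
    have normB: "bmoX_norm X f \<le> ennreal B * bmoX_star_norm X f" if "f \<in> BMOX X" for f
      using norms that by blast
    show ?thesis
    proof (intro exI[of _ ?C] conjI ballI allI impI)
      show "?C > 0" using B a by (auto simp: K_def intro!: divide_pos_pos mult_pos_pos)
      fix f assume f: "f \<in> BMOX_star X"
      then show "locally_integrable f" by (simp add: eq BMOX_def)
      show "bmo_norm f \<le> ennreal (?C * M)" if "M > 0" "bmoX_star_norm X f < ennreal M" for M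
        by (rule bmo_of_BMOX_star_eq_BMOX[OF X a ab(1) ind K1 K eq B normB f that])
    qed
  qed
  then obtain C where C: "C > 0" and f: "\<And>f. f \<in> BMOX_star X \<Longrightarrow> locally_integrable f"
    "\<And>f M. \<lbrakk>f \<in> BMOX_star X; 0 < M; bmoX_star_norm X f < ennreal M\<rbrakk> \<Longrightarrow> bmo_norm f \<le> ennreal (C * M)"
    by blast
  have bound: "bmo_norm f \<le> ennreal C * bmoX_star_norm X f" if "f \<in> BMOX_star X" for f
    using C that f(2)[OF that] by (intro ennreal_le_mult_of_all_greater) (auto simp: BMOX_star_def)
  have "f \<in> BMO" if "f \<in> BMOX_star X" for f
  proof -
    have "ennreal C * bmoX_star_norm X f < \<infinity>"
      using that by (auto simp: BMOX_star_def ennreal_mult_less_top)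
    then show ?thesis
      using f(1)[OF that] bound[OF that] by (auto simp: BMO_def intro: le_less_trans)
  qed
  then show ?thesis using C bound by blast
qed

end
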